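(* Let $X$ be a connected topological space with a disconnecting interval $J$ and let $f:X\to X$ be a continuous map. Then $$\overline{\operatorname{Rec}(f)}\cap J=\overline{\operatorname{Per}(f)}\cap J.$$
   Context: A free interval of a topological space $X$ is an open subset of $X$ homeomorphic to an open interval of the real line. If $X$ is connected, a free interval $J$ of $X$ is a disconnecting interval if $X\setminus\{x\}$ has exactly two connected components for every $x\in J$. $\operatorname{Per}(f)$ is the set of periodic points of $f$ (points $x$ with $f^n(x)=x$ for some $n\ge 1$). $\operatorname{Rec}(f)$ is the set of recurrent points of $f$ (points $x$ such that for every neighborhood $U$ of $x$ there are arbitrarily large $n$ with $f^n(x)\in U$). Closures are taken in $X$. *)

theory Defs
  imports "HOL-Analysis.Analysis"
begin

text \<open>Spaces are types of class \<open>topological_space\<close> (no separation axioms).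
  Intervals may be unbounded; the empty set does not count as one.\<close>

definition free_interval :: "'a::topological_space set \<Rightarrow> bool" where
  "free_interval J \<longleftrightarrow> open J \<and>
     (\<exists>I :: real set. open I \<and> is_interval I \<and> I \<noteq> {} \<and> J homeomorphic I)"

definition disconnecting_interval :: "'a::topological_space set \<Rightarrow> bool" where
  "disconnecting_interval J \<longleftrightarrow> free_interval J \<and>
     (\<forall>x\<in>J. card (components (UNIV - {x})) = 2)"

definition Per :: "('a \<Rightarrow> 'a) \<Rightarrow> 'a set" where
  "Per f = {x. \<exists>n\<ge>1. (f ^^ n) x = x}"

definition Rec :: "('a::topological_space \<Rightarrow> 'a) \<Rightarrow> 'a set" where
  "Rec f = {x. \<forall>U. open U \<and> x \<in> U \<longrightarrow> (\<forall>N. \<exists>n\<ge>N. (f ^^ n) x \<in> U)}"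

end

theory Submission
  imports Defs
begin

text \<open>Removing a point \<open>x\<close> of \<open>J\<close> leaves two open connected sets \<open>L x\<close> and \<open>R x\<close>, which order \<open>X\<close>
  around \<open>J\<close>. As \<open>X\<close> need not be Hausdorff, a point of \<open>X\<close> may be inseparable from \<open>x\<close>; hence a
  map that moves the left end of a subinterval of \<open>J\<close> up and its right end down need not have a fixed
  point in it. What survives is that a map moving the left end \<^emph>\<open>down\<close> and the right end
  \<^emph>\<open>up\<close> has a fixed point, and that intermediate values in \<open>J\<close> are attained.

  Suppose a subinterval of \<open>J\<close> has no periodic points. If \<open>f\<^sup>m x = z < x\<close> in it, then these two
  facts keep the whole orbit of \<open>x\<close> under \<open>f\<^sup>m\<close> in \<open>L x\<close>; so no point can return to the
  subinterval both above and below itself (compare at a common multiple of the two return times).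
  Let \<open>x\<close> be recurrent with \<open>f\<^sup>m x = z < x\<close>, and take a later return \<open>x' = f\<^sup>n x < x\<close>
  close to \<open>x\<close>. Since \<open>z\<close> goes up to \<open>x'\<close>, also \<open>z' = f\<^sup>m x' > z\<close>. A still closer return
  \<open>x'' = f\<^sup>N x\<close> has \<open>f\<^sup>m x'' < z'\<close> and \<open>x' < x''\<close>, so the \<open>(N - n)\<close>-th iterate moves
  \<open>z'\<close> down and \<open>x' > z'\<close> up, a contradiction.\<close>

section \<open>Iterates, neighbourhoods in the line, periodic points as recurrent points\<close>

lemma continuous_on_funpow:
  fixes f :: "'a::topological_space \<Rightarrow> 'a"
  assumes "continuous_on UNIV f"
  shows "continuous_on UNIV (f ^^ n)"
proof (induction n)
  case (Suc n)
  then show ?case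
    using continuous_on_compose[of UNIV "f ^^ n" f] continuous_on_subset[OF assms] by simp
qed (simp add: id_def)

lemma open_real_near:
  fixes S :: "real set"
  assumes "open S" "s \<in> S"
  obtains d where "d > 0" "\<And>t. \<bar>t - s\<bar> < d \<Longrightarrow> t \<in> S"
  using assms unfolding open_dist dist_real_def by blast

lemma Per_subset_Rec: "Per f \<subseteq> Rec f"
proof
  fix x assume "x \<in> Per f"
  then obtain p where p: "p \<ge> 1" "(f ^^ p) x = x"
    by (auto simp: Per_def)
  have "(f ^^ (p * j)) x = x" for j
    by (induction j) (simp_all add: p funpow_add)
  moreover have "p * N \<ge> N" for N
    using p by simp
  ultimately show "x \<in> Rec f"
    unfolding Rec_def mem_Collect_eq by metis
qed

section \<open>Dynamics on an interval of cut points without periodic points\<close>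

text \<open>The nested open sides \<open>L s\<close> and \<open>R s\<close> extend the order of the
  coordinate to comparisons of arbitrary points of the space with \<open>\<phi> s\<close>, so an
  iterate can be said to move a point down or up even when its image leaves the interval.\<close>

locale aperiodic_cut_interval =
  fixes f :: "'a::topological_space \<Rightarrow> 'a" and I :: "real set" and \<phi> :: "real \<Rightarrow> 'a"
    and L R :: "real \<Rightarrow> 'a set"
  assumes cont_f: "continuous_on UNIV f"
    and open_I: "open I" and interval_I: "is_interval I"
    and cont: "continuous_on I \<phi>"
    and open_image: "\<And>V. open V \<Longrightarrow> V \<subseteq> I \<Longrightarrow> open (\<phi> ` V)"
    and open_L: "\<And>s. s \<in> I \<Longrightarrow> open (L s)" and open_R: "\<And>s. s \<in> I \<Longrightarrow> open (R s)"
    and disjoint: "\<And>s. s \<in> I \<Longrightarrow> L s \<inter> R s = {}"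
    and union: "\<And>s. s \<in> I \<Longrightarrow> L s \<union> R s = UNIV - {\<phi> s}"
    and less_L: "\<And>s t. s \<in> I \<Longrightarrow> t \<in> I \<Longrightarrow> s < t \<Longrightarrow> \<phi> s \<in> L t"
    and less_R: "\<And>s t. s \<in> I \<Longrightarrow> t \<in> I \<Longrightarrow> s < t \<Longrightarrow> \<phi> t \<in> R s"
    and L_mono: "\<And>s t. s \<in> I \<Longrightarrow> t \<in> I \<Longrightarrow> s < t \<Longrightarrow> L s \<subseteq> L t"
    and R_mono: "\<And>s t. s \<in> I \<Longrightarrow> t \<in> I \<Longrightarrow> s < t \<Longrightarrow> R t \<subseteq> R s"
    and aperiodic: "\<And>s n. s \<in> I \<Longrightarrow> n \<ge> 1 \<Longrightarrow> (f ^^ n) (\<phi> s) \<noteq> \<phi> s"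
begin

text \<open>Reversing the coordinate swaps the two sides and preserves every assumption, so each
  result about downward moves also yields its upward counterpart.\<close>

lemma mirror:
  "aperiodic_cut_interval f (uminus ` I) (\<lambda>s. \<phi> (- s)) (\<lambda>s. R (- s)) (\<lambda>s. L (- s))"
proof
  have neg: "s \<in> uminus ` I \<longleftrightarrow> - s \<in> I" for s
    by force
  show "open (uminus ` I)"
    using open_I by (rule open_negations)
  show "is_interval (uminus ` I)"
    using interval_I by simp
  show "continuous_on (uminus ` I) (\<lambda>s. \<phi> (- s))"
    by (rule continuous_on_compose2[OF cont]) (auto intro: continuous_intros)
  show "open ((\<lambda>s. \<phi> (- s)) ` V)" if "open V" "V \<subseteq> uminus ` I" for V
  proof -
    have "open (\<phi> ` (uminus ` V))"
      using that by (intro open_image open_negations) auto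
    then show ?thesis
      by (simp add: image_image)
  qed
  show "open (R (- s))" "open (L (- s))" "R (- s) \<inter> L (- s) = {}"
    "R (- s) \<union> L (- s) = UNIV - {\<phi> (- s)}" if "s \<in> uminus ` I" for s
    using that open_L open_R disjoint union by (simp_all add: neg Int_commute Un_commute)
  show "\<phi> (- s) \<in> R (- t)" "\<phi> (- t) \<in> L (- s)" "R (- s) \<subseteq> R (- t)" "L (- t) \<subseteq> L (- s)"
    if "s \<in> uminus ` I" "t \<in> uminus ` I" "s < t" for s t
    using that less_L less_R L_mono R_mono by (simp_all add: neg)
  show "(f ^^ n) (\<phi> (- s)) \<noteq> \<phi> (- s)" if "s \<in> uminus ` I" "n \<ge> 1" for s n
    using that aperiodic by (simp add: neg)
qed (rule cont_f)

lemma between: "s \<in> I \<Longrightarrow> t \<in> I \<Longrightarrow> s \<le> u \<Longrightarrow> u \<le> t \<Longrightarrow> u \<in> I"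
  using interval_I unfolding is_interval_1 by blast

lemma cases_L_R: "s \<in> I \<Longrightarrow> y = \<phi> s \<or> y \<in> L s \<or> y \<in> R s"
  using union by blast

lemma cont_iterate: "continuous_on I (\<lambda>s. (f ^^ k) (\<phi> s))"
  using continuous_on_compose2[OF continuous_on_funpow[OF cont_f] cont] by simp

lemma iterate_near:
  assumes "s \<in> I" "open W" "(f ^^ k) (\<phi> s) \<in> W"
  obtains e where "e > 0" "\<And>t. \<bar>t - s\<bar> < e \<Longrightarrow> t \<in> I \<and> (f ^^ k) (\<phi> t) \<in> W"
proof -
  have "open ((\<lambda>t. (f ^^ k) (\<phi> t)) -` W \<inter> I)"
    using cont_iterate open_I \<open>open W\<close> continuous_on_open_vimage by blast
  moreover have "s \<in> (\<lambda>t. (f ^^ k) (\<phi> t)) -` W \<inter> I"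
    using assms by simp
  ultimately show thesis
    using open_real_near that by (metis (no_types, lifting) IntD1 IntD2 vimageD)
qed

text \<open>Take the supremum of the points moved down: openness of the sides and aperiodicity rule
  out both directions there. Monotonicity of the sides helps only in this orientation: an image in
  \<open>L \<sigma>\<close> lies in \<open>L t\<close> for \<open>t > \<sigma>\<close>, and an image
  in \<open>R \<sigma>\<close> lies in \<open>R s\<close> for \<open>s < \<sigma>\<close>.\<close>

lemma no_down_up:
  assumes "u \<in> I" "v \<in> I" "u < v" "k \<ge> 1"
    and down: "(f ^^ k) (\<phi> u) \<in> L u" and up: "(f ^^ k) (\<phi> v) \<in> R v"
  shows False
proof -
  define S where "S = {s \<in> {u..v}. (f ^^ k) (\<phi> s) \<in> L s}"
  define \<sigma> where "\<sigma> = Sup S"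
  have "u \<in> S"
    using assms by (simp add: S_def)
  have bdd: "bdd_above S"
    unfolding S_def by (rule bdd_aboveI[of _ v]) auto
  have "u \<le> \<sigma>"
    unfolding \<sigma>_def using \<open>u \<in> S\<close> bdd by (rule cSup_upper)
  moreover have "\<sigma> \<le> v"
    unfolding \<sigma>_def using \<open>u \<in> S\<close> by (intro cSup_least) (auto simp: S_def)
  ultimately have "\<sigma> \<in> I"
    using between assms by blast
  then consider "(f ^^ k) (\<phi> \<sigma>) \<in> L \<sigma>" | "(f ^^ k) (\<phi> \<sigma>) \<in> R \<sigma>"
    using cases_L_R aperiodic \<open>k \<ge> 1\<close> by blast
  then show False
  proof cases
    case 1
    then obtain e where e: "e > 0" "\<And>t. \<bar>t - \<sigma>\<bar> < e \<Longrightarrow> t \<in> I \<and> (f ^^ k) (\<phi> t) \<in> L \<sigma>"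
      using iterate_near open_L \<open>\<sigma> \<in> I\<close> by metis
    have "\<sigma> \<noteq> v"
      using 1 up disjoint \<open>v \<in> I\<close> by blast
    then have "\<sigma> < v"
      using \<open>\<sigma> \<le> v\<close> by simp
    \<comment> \<open>A point beyond the supremum, still at most \<open>v\<close> and close enough
      to \<sigma> to be sent into \<open>L \<sigma>\<close>, hence into \<open>L t\<close>.\<close>
    define t where "t = min v (\<sigma> + e / 2)"
    have t: "\<sigma> < t" "t \<le> v" "\<bar>t - \<sigma>\<bar> < e"
      using \<open>\<sigma> < v\<close> \<open>e > 0\<close> by (auto simp: t_def min_def)
    then have "t \<in> I" "(f ^^ k) (\<phi> t) \<in> L t"
      using e(2) L_mono \<open>\<sigma> \<in> I\<close> by blast+
    then have "t \<in> S"
      using t \<open>u \<le> \<sigma>\<close> by (simp add: S_def)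
    then have "t \<le> \<sigma>"
      unfolding \<sigma>_def using bdd by (rule cSup_upper)
    then show False
      using t by simp
  next
    case 2
    then obtain e where e: "e > 0" "\<And>t. \<bar>t - \<sigma>\<bar> < e \<Longrightarrow> t \<in> I \<and> (f ^^ k) (\<phi> t) \<in> R \<sigma>"
      using iterate_near open_R \<open>\<sigma> \<in> I\<close> by metis
    obtain s where s: "s \<in> S" "\<sigma> - e < s"
      using less_cSup_iff[of S "\<sigma> - e"] \<open>u \<in> S\<close> bdd \<open>e > 0\<close> by (auto simp: \<sigma>_def)
    have "s \<le> \<sigma>"
      unfolding \<sigma>_def using \<open>s \<in> S\<close> bdd by (rule cSup_upper)
    then have "s \<in> I" "(f ^^ k) (\<phi> s) \<in> R \<sigma>"
      using e(2)[of s] s by auto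
    then have "(f ^^ k) (\<phi> s) \<in> R s"
      using \<open>s \<le> \<sigma>\<close> R_mono[of s \<sigma>] \<open>\<sigma> \<in> I\<close> by (cases "s = \<sigma>") auto
    moreover have "(f ^^ k) (\<phi> s) \<in> L s"
      using \<open>s \<in> S\<close> by (simp add: S_def)
    ultimately show False
      using disjoint \<open>s \<in> I\<close> by blast
  qed
qed

text \<open>The image of the segment is connected and meets both open sides of
  \<open>\<phi> a\<close>, so it must contain the one point that they omit.\<close>

lemma intermediate_value:
  assumes "u \<in> I" "v \<in> I" "u < v" "a \<in> I"
    and u: "(f ^^ k) (\<phi> u) \<in> R a" and v: "(f ^^ k) (\<phi> v) \<in> L a"
  obtains t where "u < t" "t < v" "(f ^^ k) (\<phi> t) = \<phi> a"
proof -
  let ?A = "(\<lambda>s. (f ^^ k) (\<phi> s)) ` {u..v}"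
  have "{u..v} \<subseteq> I"
    using between[OF \<open>u \<in> I\<close> \<open>v \<in> I\<close>] by (simp add: subset_iff)
  then have "connected ?A"
    using cont_iterate by (intro connected_continuous_image) (auto intro: continuous_on_subset)
  moreover have "L a \<inter> ?A \<noteq> {}" "R a \<inter> ?A \<noteq> {}"
    using u v \<open>u < v\<close> by fastforce+
  ultimately have "\<not> ?A \<subseteq> L a \<union> R a"
    using connectedD[of ?A "L a" "R a"] open_L open_R disjoint \<open>a \<in> I\<close> by blast
  then obtain t where t: "u \<le> t" "t \<le> v" "(f ^^ k) (\<phi> t) = \<phi> a"
    using cases_L_R \<open>a \<in> I\<close> by fastforce
  moreover have "t \<noteq> u" "t \<noteq> v"
    using u v t(3) union \<open>a \<in> I\<close> by blast+
  ultimately have "u < t" "t < v"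
    by simp_all
  then show thesis
    using that t(3) by blast
qed

text \<open>Induction along the multiples of \<open>m\<close>. A first multiple moving
  \<open>x\<close> up would also move some point between \<open>z\<close> and \<open>x\<close> down,
  against \<open>no_down_up\<close>.\<close>

lemma stays_below:
  assumes "x \<in> I" "z \<in> I" "z < x" "m \<ge> 1" and z: "(f ^^ m) (\<phi> x) = \<phi> z"
  shows "(f ^^ (Suc j * m)) (\<phi> x) \<in> L x"
proof (induction j)
  case 0
  then show ?case
    using assms less_L by simp
next
  case (Suc j)
  define k where "k = Suc j * m"
  have fz: "(f ^^ k) (\<phi> z) = (f ^^ (k + m)) (\<phi> x)"
    using z by (simp add: funpow_add)
  have "(f ^^ (k + m)) (\<phi> x) \<notin> R x"
  proof
    assume up: "(f ^^ (k + m)) (\<phi> x) \<in> R x"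
    \<comment> \<open>The \<open>k\<close>-th iterate sends \<open>z\<close> above \<open>x\<close>
      and \<open>x\<close> below itself, so it sends some \<open>t\<close> between them to
      \<open>x\<close>; a further \<open>m\<close> steps lead from there to
      \<open>z < t\<close>.\<close>
    obtain t where t: "z < t" "t < x" "(f ^^ k) (\<phi> t) = \<phi> x"
    proof (rule intermediate_value)
      show "(f ^^ k) (\<phi> z) \<in> R x"
        using up fz by simp
      show "(f ^^ k) (\<phi> x) \<in> L x"
        using Suc by (simp add: k_def)
    qed (use assms in auto)
    have "t \<in> I"
      using between assms t by (meson less_imp_le)
    have "(f ^^ (k + m)) (\<phi> t) = \<phi> z"
      using t z by (simp add: add.commute[of k] funpow_add)
    then have "(f ^^ (k + m)) (\<phi> t) \<in> L t"
      using less_L t \<open>z \<in> I\<close> \<open>t \<in> I\<close> by simp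
    then show False
      using no_down_up[OF \<open>t \<in> I\<close> \<open>x \<in> I\<close> \<open>t < x\<close> _ _ up] \<open>m \<ge> 1\<close> by simp
  qed
  moreover have "(f ^^ (k + m)) (\<phi> x) \<noteq> \<phi> x"
    using aperiodic \<open>x \<in> I\<close> \<open>m \<ge> 1\<close> by simp
  ultimately show ?case
    using cases_L_R[OF \<open>x \<in> I\<close>] by (auto simp: k_def add_ac)
qed

lemma no_return_both_sides:
  assumes "x \<in> I" "y \<in> I" "z \<in> I" "y < x" "x < z" "m \<ge> 1" "n \<ge> 1"
    and "(f ^^ m) (\<phi> x) = \<phi> y" "(f ^^ n) (\<phi> x) = \<phi> z"
  shows False
proof -
  interpret mirror: aperiodic_cut_interval f "uminus ` I" "\<lambda>s. \<phi> (- s)" "\<lambda>s. R (- s)" "\<lambda>s. L (- s)"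
    by (rule mirror)
  \<comment> \<open>As \<open>m\<close> and \<open>n\<close> are positive, both exponents equal
    \<open>m * n\<close>: one iterate would send \<open>x\<close> to both sides of itself.\<close>
  have "(f ^^ (Suc (n - 1) * m)) (\<phi> x) \<in> L x"
    using assms stays_below by blast
  moreover have "(f ^^ (Suc (m - 1) * n)) (\<phi> x) \<in> R x"
    using mirror.stays_below[of "- x" "- z" n "m - 1"] assms by simp
  ultimately show False
    using disjoint assms by (auto simp: mult.commute)
qed

text \<open>Small coordinate balls have open images in the whole space, so recurrence gives returns
  that have a coordinate close to \<open>x\<close>.\<close>

lemma Rec_return:
  assumes "\<phi> x \<in> Rec f" "d > 0" "\<And>t. \<bar>t - x\<bar> < d \<Longrightarrow> t \<in> I"
  obtains n y where "n \<ge> N" "\<bar>y - x\<bar> < d" "(f ^^ n) (\<phi> x) = \<phi> y"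
proof -
  have "open (\<phi> ` ball x d)"
    using assms by (intro open_image) (auto simp: dist_real_def abs_minus_commute)
  moreover have "\<phi> x \<in> \<phi> ` ball x d"
    using \<open>d > 0\<close> by simp
  ultimately obtain n where "n \<ge> N" "(f ^^ n) (\<phi> x) \<in> \<phi> ` ball x d"
    using assms(1) unfolding Rec_def by blast
  then show thesis
    using that by (auto simp: dist_real_def abs_minus_commute)
qed

lemma not_Rec_if_return_below:
  assumes "x \<in> I" "z \<in> I" "z < x" "m \<ge> 1" and z: "(f ^^ m) (\<phi> x) = \<phi> z"
  shows "\<phi> x \<notin> Rec f"
proof
  assume rec: "\<phi> x \<in> Rec f"
  \<comment> \<open>\<open>p\<close> controls how close to \<open>x\<close> the return is, and
    \<open>q\<close> how far up its \<open>m\<close>-th image may lie; continuity of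
    \<open>f ^^ m\<close> at \<open>x\<close> allows any \<open>q > z\<close>.\<close>
  have closer: "\<exists>n y y'. n \<ge> N \<and> p < y \<and> y < x \<and> y \<in> I \<and> y' \<in> I \<and> y' < q \<and>
      (f ^^ n) (\<phi> x) = \<phi> y \<and> (f ^^ m) (\<phi> y) = \<phi> y'"
    if pq: "p < x" "z < q" and N: "N \<ge> 1" for N p q
  proof -
    have "open (\<phi> ` (I \<inter> {..<q}))"
      using open_I by (intro open_image) auto
    moreover have "(f ^^ m) (\<phi> x) \<in> \<phi> ` (I \<inter> {..<q})"
      using z pq \<open>z \<in> I\<close> by auto
    ultimately obtain e where e: "e > 0"
        "\<And>t. \<bar>t - x\<bar> < e \<Longrightarrow> t \<in> I \<and> (f ^^ m) (\<phi> t) \<in> \<phi> ` (I \<inter> {..<q})"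
      using iterate_near \<open>x \<in> I\<close> by metis
    obtain n y where n: "n \<ge> N" "\<bar>y - x\<bar> < min e (x - p)" "(f ^^ n) (\<phi> x) = \<phi> y"
      by (rule Rec_return[OF rec, of "min e (x - p)" N]) (use e pq in auto)
    have y: "y \<in> I" "(f ^^ m) (\<phi> y) \<in> \<phi> ` (I \<inter> {..<q})"
      using e(2)[of y] n by auto
    have "y \<noteq> x"
      using aperiodic[of x n] n N \<open>x \<in> I\<close> by auto
    \<comment> \<open>A return above \<open>x\<close> would coexist with the return \<open>z\<close>
      below it.\<close>
    moreover have "\<not> x < y"
      using no_return_both_sides[of x z y m n] assms n N y by auto
    ultimately have "y < x"
      by simp
    with n y show ?thesis
      by auto
  qed
  \<comment> \<open>The midpoint serves as both bounds, which gives \<open>z' < w < x'\<close> and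
    \<open>z < x'\<close>.\<close>
  define w where "w = (x + z) / 2"
  obtain n x' z' where x': "n \<ge> m + 1" "w < x'" "x' < x" "x' \<in> I" "z' \<in> I" "z' < w"
      "(f ^^ n) (\<phi> x) = \<phi> x'" "(f ^^ m) (\<phi> x') = \<phi> z'"
    using closer[of w w "m + 1"] \<open>z < x\<close> by (auto simp: w_def)
  have "(f ^^ (n - m)) (\<phi> z) = (f ^^ (n - m + m)) (\<phi> x)"
    using z by (simp only: funpow_add o_apply)
  then have up: "(f ^^ (n - m)) (\<phi> z) = \<phi> x'"
    using x' by simp
  have "(f ^^ n) (\<phi> z) = (f ^^ (n + m)) (\<phi> x)"
    using z by (simp add: funpow_add)
  also have "\<dots> = \<phi> z'"
    using x' by (simp add: add.commute[of n] funpow_add)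
  finally have zz': "(f ^^ n) (\<phi> z) = \<phi> z'" .
  have "z' \<noteq> z"
    using aperiodic[of z n] zz' x' \<open>z \<in> I\<close> by auto
  \<comment> \<open>The point \<open>z\<close> reaches \<open>x'\<close> above it after
    \<open>n - m\<close> steps, positive since \<open>n \<ge> m + 1\<close>; so its
    \<open>n\<close>-th image \<open>z'\<close> cannot lie below it.\<close>
  moreover have "\<not> z' < z"
  proof -
    have "n - m \<ge> 1" "n \<ge> 1" "z < x'"
      using x' \<open>z < x\<close> by (auto simp: w_def)
    then show ?thesis
      using no_return_both_sides[of z z' x' n "n - m"] x' up zz' \<open>z \<in> I\<close> by blast
  qed
  ultimately have "z < z'"
    by simp
  \<comment> \<open>Now that \<open>z < z'\<close>, the bound \<open>q\<close> may be
    \<open>z'\<close>; with \<open>p = x'\<close> this gives a return closer to \<open>x\<close>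
    whose \<open>m\<close>-th image is below \<open>z'\<close>.\<close>
  then obtain N x'' y where x'': "N \<ge> n + 1" "x' < x''" "x'' \<in> I" "y \<in> I" "y < z'"
      "(f ^^ N) (\<phi> x) = \<phi> x''" "(f ^^ m) (\<phi> x'') = \<phi> y"
    using closer[of x' z' "n + 1"] x' by auto
  have "(f ^^ (N - n)) (\<phi> x') = (f ^^ (N - n + n)) (\<phi> x)"
    using x' by (simp only: funpow_add o_apply)
  then have "(f ^^ (N - n)) (\<phi> x') = \<phi> x''"
    using x'' by simp
  moreover have "(f ^^ (N - n)) (\<phi> z') = \<phi> y"
  proof -
    have "(f ^^ (N - n)) (\<phi> z') = (f ^^ (N - n + (m + n))) (\<phi> x)"
      using x' by (simp only: funpow_add o_apply)
    also have "N - n + (m + n) = m + N"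
      using x'' by simp
    also have "(f ^^ (m + N)) (\<phi> x) = \<phi> y"
      using x'' by (simp add: funpow_add)
    finally show ?thesis .
  qed
  ultimately show False
    using no_down_up[of z' x' "N - n"] less_L[of y z'] less_R[of x' x''] x' x'' by fastforce
qed

text \<open>A return inside the interval differs from \<open>x\<close> by aperiodicity; one below
  \<open>x\<close> is excluded by the preceding lemma, one above by its mirror image.\<close>

lemma not_Rec:
  assumes "x \<in> I"
  shows "\<phi> x \<notin> Rec f"
proof
  assume rec: "\<phi> x \<in> Rec f"
  interpret mirror: aperiodic_cut_interval f "uminus ` I" "\<lambda>s. \<phi> (- s)" "\<lambda>s. R (- s)" "\<lambda>s. L (- s)"
    by (rule mirror)
  obtain d where "d > 0" "\<And>t. \<bar>t - x\<bar> < d \<Longrightarrow> t \<in> I"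
    using open_real_near open_I \<open>x \<in> I\<close> by blast
  then obtain n y where n: "n \<ge> 1" "y \<in> I" "(f ^^ n) (\<phi> x) = \<phi> y"
    using Rec_return[OF rec] by metis
  then have "y \<noteq> x"
    using aperiodic \<open>x \<in> I\<close> by blast
  moreover have "\<not> y < x"
    using not_Rec_if_return_below[of x y n] n rec \<open>x \<in> I\<close> by auto
  moreover have "\<not> x < y"
    using mirror.not_Rec_if_return_below[of "- x" "- y" n] n rec \<open>x \<in> I\<close> by auto
  ultimately show False
    by simp
qed

end

section \<open>The two sides of a cut point\<close>

text \<open>The sides are the two components of the complement. Without separation axioms their
  openness in the whole space is not automatic: it follows once the two halves of the interval are
  shown to lie in different components.\<close>

lemma cut_point_sides:
  fixes \<phi> :: "real \<Rightarrow> 'a::topological_space"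
  assumes conn: "connected (UNIV :: 'a set)"
    and card: "card (components (UNIV - {\<phi> s})) = 2"
    and I: "open I" "is_interval I" "s \<in> I"
    and cont: "continuous_on I \<phi>" and inj: "inj_on \<phi> I" and open_image: "open (\<phi> ` I)"
  shows "\<exists>A B. open A \<and> open B \<and> connected A \<and> connected B \<and> A \<inter> B = {} \<and>
    A \<union> B = UNIV - {\<phi> s} \<and> \<phi> ` (I \<inter> {..<s}) \<subseteq> A \<and> \<phi> ` (I \<inter> {s<..}) \<subseteq> B"
proof -
  define l where "l = \<phi> ` (I \<inter> {..<s})"
  define r where "r = \<phi> ` (I \<inter> {s<..})"
  obtain d where d: "d > 0" "\<And>t. \<bar>t - s\<bar> < d \<Longrightarrow> t \<in> I"
    using open_real_near I by blast
  have in_I: "s - d / 2 \<in> I" "s + d / 2 \<in> I"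
    using d by auto
  have "connected (I \<inter> {..<s})" "connected (I \<inter> {s<..})"
    using I by (auto simp: is_interval_connected_1[symmetric] is_interval_Int)
  then have lr_conn: "connected l" "connected r"
    unfolding l_def r_def
    by (auto intro!: connected_continuous_image continuous_on_subset[OF cont])
  have lr_sub: "l \<subseteq> UNIV - {\<phi> s}" "r \<subseteq> UNIV - {\<phi> s}"
    using inj \<open>s \<in> I\<close> by (auto simp: l_def r_def inj_on_def)
  have lr_ne: "l \<noteq> {}" "r \<noteq> {}"
    using in_I \<open>d > 0\<close> by (auto simp: l_def r_def intro!: exI[of _ "s - d / 2"] exI[of _ "s + d / 2"])
  have J: "\<phi> ` I = l \<union> r \<union> {\<phi> s}"
    using \<open>s \<in> I\<close> by (auto simp: l_def r_def) (metis Int_iff greaterThan_iff image_eqI lessThan_iff linorder_less_linear)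
  have meets: "V \<inter> l \<noteq> {} \<and> V \<inter> r \<noteq> {}" if "open V" "\<phi> s \<in> V" for V
  proof -
    have "open (\<phi> -` V \<inter> I)"
      using cont I \<open>open V\<close> continuous_on_open_vimage by blast
    moreover have "s \<in> \<phi> -` V \<inter> I"
      using that I by simp
    ultimately obtain e where e: "e > 0" "\<And>t. \<bar>t - s\<bar> < e \<Longrightarrow> t \<in> \<phi> -` V \<inter> I"
      using open_real_near by blast
    have "s - e / 2 \<in> \<phi> -` V \<inter> I" "s + e / 2 \<in> \<phi> -` V \<inter> I"
      using e by auto
    then have "\<phi> (s - e / 2) \<in> V \<inter> l" "\<phi> (s + e / 2) \<in> V \<inter> r"
      using e(1) by (auto simp: l_def r_def)
    then show ?thesis
      by blast
  qed
  obtain A B where AB: "components (UNIV - {\<phi> s}) = {A, B}" "A \<noteq> B"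
    using card unfolding card_2_iff by blast
  have comps: "A \<in> components (UNIV - {\<phi> s})" "B \<in> components (UNIV - {\<phi> s})"
    using AB by simp_all
  then have conn_AB: "connected A" "connected B" and ne: "A \<noteq> {}" "B \<noteq> {}"
    by (simp_all add: in_components_connected in_components_nonempty)
  have dis: "A \<inter> B = {}"
    using components_nonoverlap[OF comps] AB(2) by simp
  have un: "A \<union> B = UNIV - {\<phi> s}"
    using Union_components[of "UNIV - {\<phi> s}"] AB by simp
  have part: "C \<subseteq> A \<or> C \<subseteq> B" if "connected C" "C \<subseteq> UNIV - {\<phi> s}" for C
    using components_maximal[OF comps(1) that] components_maximal[OF comps(2) that] that(2) un
    by blast
  \<comment> \<open>Each component is the complement of the other, which is relatively closed; so it
    is relatively open, that is, open up to the point \<open>\<phi> s\<close>.\<close>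
  have nearly_open: "\<exists>V. open V \<and> P = V - {\<phi> s}" if "P \<in> {A, B}" for P
  proof -
    let ?S = "UNIV - {\<phi> s}"
    have "A \<union> B - P = A \<or> A \<union> B - P = B"
      using that dis by blast
    then have "closedin (top_of_set ?S) (A \<union> B - P)"
      using closedin_component[OF comps(1)] closedin_component[OF comps(2)] by metis
    then have "openin (top_of_set ?S) (?S - (A \<union> B - P))"
      by (simp add: openin_diff)
    moreover have "?S - (A \<union> B - P) = P"
      using that un by blast
    ultimately show ?thesis
      unfolding openin_open by auto
  qed
  \<comment> \<open>\<open>W\<close> cannot contain \<open>\<phi> s\<close>, as it would then meet
    \<open>l\<close>, which lies in \<open>P\<close>. So \<open>Q\<close> is open, and joining the
    interval to \<open>V\<close> makes \<open>insert (\<phi> s) P\<close> open, which disconnects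
    the space.\<close>
  have not_same: False if PQ: "{P, Q} = {A, B}" and lr: "l \<subseteq> P" "r \<subseteq> P" for P Q
  proof -
    obtain V W where V: "open V" "P = V - {\<phi> s}" and W: "open W" "Q = W - {\<phi> s}"
      using nearly_open PQ by (metis insertI1 insert_commute)
    have PQ': "P \<inter> Q = {}" "P \<union> Q = UNIV - {\<phi> s}" "Q \<noteq> {}"
      using PQ dis un ne by (auto simp: doubleton_eq_iff)
    have "\<phi> s \<notin> W"
      using meets[OF \<open>open W\<close>] W lr PQ' lr_sub by blast
    then have "W = Q"
      using W by simp
    moreover have "V \<union> \<phi> ` I = insert (\<phi> s) P"
      using V lr J by blast
    moreover have "open (V \<union> \<phi> ` I)"
      using V open_image by blast
    ultimately show False
      using connectedD[OF conn, of Q "insert (\<phi> s) P"] W PQ' by auto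
  qed
  \<comment> \<open>Every neighbourhood of \<open>\<phi> s\<close> meets both halves, hence both
    \<open>P\<close> and \<open>Q\<close>, so neither \<open>V\<close> nor \<open>W\<close> contains
    that point.\<close>
  have result: "open P \<and> open Q" if PQ: "{P, Q} = {A, B}" and lr: "l \<subseteq> P" "r \<subseteq> Q" for P Q
  proof -
    obtain V W where V: "open V" "P = V - {\<phi> s}" and W: "open W" "Q = W - {\<phi> s}"
      using nearly_open PQ by (metis insertI1 insert_commute)
    have "P \<inter> Q = {}"
      using PQ dis by (auto simp: doubleton_eq_iff)
    then have "\<phi> s \<notin> W" "\<phi> s \<notin> V"
      using meets[OF \<open>open W\<close>] meets[OF \<open>open V\<close>] V W lr lr_sub by blast+
    then show ?thesis
      using V W by simp
  qed
  consider "l \<subseteq> A" "r \<subseteq> B" | "l \<subseteq> B" "r \<subseteq> A"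
    using part[OF lr_conn(1) lr_sub(1)] part[OF lr_conn(2) lr_sub(2)] not_same[of A B] not_same[of B A]
    by auto
  then show ?thesis
    unfolding l_def[symmetric] r_def[symmetric]
  proof cases
    case 1
    with result[of A B] conn_AB dis un show "\<exists>A B. open A \<and> open B \<and> connected A \<and> connected B \<and>
        A \<inter> B = {} \<and> A \<union> B = UNIV - {\<phi> s} \<and> l \<subseteq> A \<and> r \<subseteq> B"
      by blast
  next
    case 2
    with result[of B A] conn_AB dis un show "\<exists>A B. open A \<and> open B \<and> connected A \<and> connected B \<and>
        A \<inter> B = {} \<and> A \<union> B = UNIV - {\<phi> s} \<and> l \<subseteq> A \<and> r \<subseteq> B"
      by (intro exI[of _ B] exI[of _ A]) auto
  qed
qed

section \<open>Reduction to an interval without periodic points\<close>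

theorem theorem19:
  fixes f :: "'a::topological_space \<Rightarrow> 'a" and J :: "'a set"
  assumes "connected (UNIV :: 'a set)"
    and "disconnecting_interval J"
    and "continuous_on UNIV f"
  shows "closure (Rec f) \<inter> J = closure (Per f) \<inter> J"
proof
  show "closure (Per f) \<inter> J \<subseteq> closure (Rec f) \<inter> J"
    using closure_mono[OF Per_subset_Rec] by blast
  show "closure (Rec f) \<inter> J \<subseteq> closure (Per f) \<inter> J"
  proof (rule ccontr)
    assume "\<not> ?thesis"
    then obtain x where x: "x \<in> closure (Rec f)" "x \<in> J" "x \<notin> closure (Per f)"
      by blast
    obtain I :: "real set" where J: "open J" and I: "open I" "is_interval I" "J homeomorphic I"
      and card: "\<And>y. y \<in> J \<Longrightarrow> card (components (UNIV - {y})) = 2"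
      using assms(2) unfolding disconnecting_interval_def free_interval_def by blast
    then obtain h \<phi> where hom: "homeomorphism J I h \<phi>"
      unfolding homeomorphic_def by blast
    then have h: "continuous_on J h" "h ` J = I" "\<And>y. y \<in> J \<Longrightarrow> \<phi> (h y) = y"
      and \<phi>: "continuous_on I \<phi>" "\<phi> ` I = J" "\<And>s. s \<in> I \<Longrightarrow> h (\<phi> s) = s"
      by (auto simp: homeomorphism_def)
    have inj: "inj_on \<phi> I"
      using \<phi>(3) by (rule inj_on_inverseI)
    have open_image: "open (\<phi> ` V)" if "open V" "V \<subseteq> I" for V
    proof -
      \<comment> \<open>A preimage under \<open>h\<close> is relatively open in \<open>J\<close>,
        and \<open>J\<close> is itself open.\<close>
      have "\<phi> ` V = h -` V \<inter> J"
        using that h \<phi> by force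
      then show ?thesis
        using h(1) J \<open>open V\<close> continuous_on_open_vimage by metis
    qed
    have "\<forall>s\<in>I. \<exists>A B. open A \<and> open B \<and> connected A \<and> connected B \<and> A \<inter> B = {} \<and>
        A \<union> B = UNIV - {\<phi> s} \<and> \<phi> ` (I \<inter> {..<s}) \<subseteq> A \<and> \<phi> ` (I \<inter> {s<..}) \<subseteq> B"
      using cut_point_sides[OF assms(1) card I(1,2) _ \<phi>(1) inj] \<phi>(2) J by blast
    then obtain L R where LR: "\<And>s. s \<in> I \<Longrightarrow> open (L s) \<and> open (R s) \<and> connected (L s) \<and>
        connected (R s) \<and> L s \<inter> R s = {} \<and> L s \<union> R s = UNIV - {\<phi> s} \<and>
        \<phi> ` (I \<inter> {..<s}) \<subseteq> L s \<and> \<phi> ` (I \<inter> {s<..}) \<subseteq> R s"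
      by metis
    have less: "\<phi> s \<in> L t" "\<phi> t \<in> R s" if "s \<in> I" "t \<in> I" "s < t" for s t
      using LR[OF that(1)] LR[OF that(2)] that by auto
    have connected_image: "connected (\<phi> ` K)" if "K \<subseteq> I" "is_interval K" for K
      using that by (auto intro!: connected_continuous_image continuous_on_subset[OF \<phi>(1)]
          simp: is_interval_connected_1[symmetric])
    have side: "C \<subseteq> L t \<or> C \<subseteq> R t" if "connected C" "\<phi> t \<notin> C" "t \<in> I" for C t
      using connectedD[OF that(1), of "L t" "R t"] LR[OF \<open>t \<in> I\<close>] that(2) by blast
    \<comment> \<open>Adjoining to \<open>L s\<close> the part of the interval up to
      \<open>s\<close> gives a connected set that misses \<open>\<phi> t\<close> and contains
      \<open>\<phi> s\<close>, so it lies on the lower side of \<open>\<phi> t\<close>. The upper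
      sides are treated symmetrically.\<close>
    have mono: "L s \<subseteq> L t" "R t \<subseteq> R s" if st: "s \<in> I" "t \<in> I" "s < t" for s t
    proof -
      obtain d where d: "d > 0" "\<And>u. \<bar>u - s\<bar> < d \<Longrightarrow> u \<in> I"
        using open_real_near I(1) \<open>s \<in> I\<close> by blast
      obtain e where e: "e > 0" "\<And>u. \<bar>u - t\<bar> < e \<Longrightarrow> u \<in> I"
        using open_real_near I(1) \<open>t \<in> I\<close> by blast
      have "connected (L s \<union> \<phi> ` (I \<inter> {..s}))"
      proof (rule connected_Un)
        have "\<phi> (s - d / 2) \<in> L s \<inter> \<phi> ` (I \<inter> {..s})"
          using d less(1)[of "s - d / 2" s] st by auto
        then show "L s \<inter> \<phi> ` (I \<inter> {..s}) \<noteq> {}"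
          by blast
      qed (use LR st I in \<open>auto intro!: connected_image is_interval_Int\<close>)
      moreover have "\<phi> t \<notin> L s \<union> \<phi> ` (I \<inter> {..s})"
        using LR[OF st(1)] less(2)[OF st] st inj by (auto simp: inj_on_def)
      ultimately have "L s \<union> \<phi> ` (I \<inter> {..s}) \<subseteq> L t \<or> L s \<union> \<phi> ` (I \<inter> {..s}) \<subseteq> R t"
        using side st by blast
      moreover have "\<phi> s \<in> L s \<union> \<phi> ` (I \<inter> {..s})" "\<phi> s \<notin> R t"
        using st less(1)[OF st] LR[OF st(2)] by auto
      ultimately show "L s \<subseteq> L t"
        by blast
      have "connected (R t \<union> \<phi> ` (I \<inter> {t..}))"
      proof (rule connected_Un)
        have "\<phi> (t + e / 2) \<in> R t \<inter> \<phi> ` (I \<inter> {t..})"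
          using e less(2)[of t "t + e / 2"] st by auto
        then show "R t \<inter> \<phi> ` (I \<inter> {t..}) \<noteq> {}"
          by blast
      qed (use LR st I in \<open>auto intro!: connected_image is_interval_Int\<close>)
      moreover have "\<phi> s \<notin> R t \<union> \<phi> ` (I \<inter> {t..})"
        using LR[OF st(2)] less(1)[OF st] st inj by (auto simp: inj_on_def)
      ultimately have "R t \<union> \<phi> ` (I \<inter> {t..}) \<subseteq> L s \<or> R t \<union> \<phi> ` (I \<inter> {t..}) \<subseteq> R s"
        using side st by blast
      moreover have "\<phi> t \<in> R t \<union> \<phi> ` (I \<inter> {t..})" "\<phi> t \<notin> L s"
        using st less(2)[OF st] LR[OF st(1)] by auto
      ultimately show "R t \<subseteq> R s"
        by blast
    qed
    \<comment> \<open>Off the closure of \<open>Per f\<close> there is room for a coordinate ball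
      around \<open>h x\<close> whose image has no periodic points.\<close>
    define U where "U = - closure (Per f)"
    have U: "open U" "x \<in> U" "U \<inter> Per f = {}"
      using x closure_subset[of "Per f"] by (auto simp: U_def)
    have "open (\<phi> -` U \<inter> I)" "h x \<in> \<phi> -` U \<inter> I"
      using \<phi>(1) I(1) U continuous_on_open_vimage h x by blast+
    then obtain d where d: "d > 0" "ball (h x) d \<subseteq> \<phi> -` U \<inter> I"
      unfolding open_contains_ball by blast
    interpret aperiodic_cut_interval f "ball (h x) d" \<phi> L R
    proof
      show "is_interval (ball (h x) d)"
        by (simp add: is_interval_ball_real)
      show "continuous_on (ball (h x) d) \<phi>"
        using \<phi>(1) d continuous_on_subset by blast
      show "(f ^^ n) (\<phi> s) \<noteq> \<phi> s" if "s \<in> ball (h x) d" "n \<ge> 1" for s n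
      proof
        assume "(f ^^ n) (\<phi> s) = \<phi> s"
        then have "\<phi> s \<in> Per f"
          using \<open>n \<ge> 1\<close> by (auto simp: Per_def)
        then show False
          using that d U by blast
      qed
      show "open (\<phi> ` V)" if "open V" "V \<subseteq> ball (h x) d" for V
        using open_image that d by blast
      have in_I: "s \<in> I" if "s \<in> ball (h x) d" for s
        using that d by blast
      show "open (L s)" "open (R s)" "L s \<inter> R s = {}" "L s \<union> R s = UNIV - {\<phi> s}"
        if "s \<in> ball (h x) d" for s
        using LR[OF in_I[OF that]] by simp_all
      show "\<phi> s \<in> L t" "\<phi> t \<in> R s" "L s \<subseteq> L t" "R t \<subseteq> R s"
        if "s \<in> ball (h x) d" "t \<in> ball (h x) d" "s < t" for s t
        using less mono in_I that by simp_all
    qed (simp_all add: assms(3))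
    have "open (\<phi> ` ball (h x) d)"
      using open_image d by blast
    moreover have "x \<in> \<phi> ` ball (h x) d"
      using image_eqI[of x \<phi> "h x" "ball (h x) d"] h(3)[OF x(2)] d(1) by simp
    \<comment> \<open>The image of the ball is a neighbourhood of \<open>x\<close>, a point of the
      closure of \<open>Rec f\<close>, so it must contain a recurrent point.\<close>
    ultimately have "\<phi> ` ball (h x) d \<inter> Rec f \<noteq> {}"
      using x(1) open_Int_closure_eq_empty[of "\<phi> ` ball (h x) d" "Rec f"] by blast
    then show False
      using not_Rec by blast
  qed
qed

end
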